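(* Let $A\in\mathbb R^{m\times N}$, $b\in\mathbb R^m$, $E\in\mathbb R^{r\times N}$, $\sigma>0$, let $\|\cdot\|_\star$ be a norm on $\mathbb R^r$ with dual norm $\|\cdot\|_\diamond$, and let $\mathcal C=\{x\in\mathbb R^N\mid Cx\le d\}$ with $C\in\mathbb R^{\ell\times N}$, $d\in\mathbb R^\ell$. Consider the BPDN-like problem $$(P):\quad \min_{x\in\mathcal C,\ \|Ax-b\|_2\le\sigma}\|Ex\|_\star,$$ assumed feasible, where $\|b\|_2>\sigma$, $0\in\mathcal C$, and the optimal value of $(P)$ is positive. Let $$(D):\quad \min_{y\in\mathbb R^m,\ \mu\in\mathbb R^\ell_+,\ \|v\|_\diamond\le1}\Big\{b^Ty+\sigma\|y\|_2+d^T\mu\ :\ A^Ty+E^Tv+C^T\mu=0\Big\}.$$ Assume that strong duality holds. Then the following hold. (i) Let $(y_*,\mu_*,v_* )$ be a solution of $(D)$. Then $y_*\ne0$, and for any solution $x_*$ of $(P)$, $Ax_*-b=\frac{\sigma y_*}{\|y_*\|_2}$. Further, if $\mathcal C$ is a polyhedral cone (i.e., $d=0$), then $\|Ex_*\|_\star=-b^Ty_*-\sigma\|y_*\|_2$. (ii) Suppose $d=0$. Let $(y_*,\mu_*,v_* )$ and $(y_*',\mu_*',v_*')$ be two arbitrary solutions of $(D)$. Then $y_*=y_*'$.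
   Context: The dual norm is $\|z\|_\diamond:=\sup\{z^Tv\mid\|v\|_\star\le1\}$. "Strong duality holds" means that $(D)$ attains a minimizer and the optimal value of $(P)$ equals the negative of the optimal value of $(D)$. *)

theory Defs
  imports "HOL-Analysis.Analysis"
begin

text \<open>An arbitrary norm on a real vector space, as a predicate: the ambient type already
  carries a canonical norm (the Euclidean one on \<^typ>\<open>real ^ 'r\<close>).\<close>

definition is_norm :: "('a :: real_vector \<Rightarrow> real) \<Rightarrow> bool" where
  "is_norm N \<longleftrightarrow>
     (\<forall>x. 0 \<le> N x) \<and>
     (\<forall>x. N x = 0 \<longleftrightarrow> x = 0) \<and>
     (\<forall>c x. N (c *\<^sub>R x) = \<bar>c\<bar> * N x) \<and>
     (\<forall>x y. N (x + y) \<le> N x + N y)"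

text \<open>For a norm in finite dimension the set below is nonempty and bounded above,
  so the real supremum is the genuine one.\<close>

definition dual_norm :: "('a :: euclidean_space \<Rightarrow> real) \<Rightarrow> 'a \<Rightarrow> real" where
  "dual_norm N z = Sup {z \<bullet> v | v. N v \<le> 1}"

text \<open>The infimum is taken in the extended reals: \<open>\<infinity>\<close> for an infeasible problem,
  \<open>-\<infinity>\<close> for an unbounded one.\<close>

definition optimal_value :: "('a \<Rightarrow> real) \<Rightarrow> 'a set \<Rightarrow> ereal" where
  "optimal_value f S = (INF x\<in>S. ereal (f x))"

definition is_solution :: "('a \<Rightarrow> real) \<Rightarrow> 'a set \<Rightarrow> 'a \<Rightarrow> bool" where
  "is_solution f S x \<longleftrightarrow> is_arg_min f (\<lambda>u. u \<in> S) x"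

text \<open>The order on vectors is the componentwise one.\<close>

definition primal_feasible ::
  "real ^ 'n ^ 'm \<Rightarrow> real ^ 'm \<Rightarrow> real \<Rightarrow> real ^ 'n ^ 'l \<Rightarrow> real ^ 'l \<Rightarrow> (real ^ 'n) set" where
  "primal_feasible A b \<sigma> C d = {x. C *v x \<le> d \<and> norm (A *v x - b) \<le> \<sigma>}"

definition primal_objective ::
  "real ^ 'n ^ 'r \<Rightarrow> (real ^ 'r \<Rightarrow> real) \<Rightarrow> real ^ 'n \<Rightarrow> real" where
  "primal_objective E N x = N (E *v x)"

definition dual_feasible ::
  "real ^ 'n ^ 'm \<Rightarrow> real ^ 'n ^ 'r \<Rightarrow> (real ^ 'r \<Rightarrow> real) \<Rightarrow> real ^ 'n ^ 'l \<Rightarrow>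
   ((real ^ 'm) \<times> (real ^ 'l) \<times> (real ^ 'r)) set" where
  "dual_feasible A E N C =
     {(y, \<mu>, v). 0 \<le> \<mu> \<and> dual_norm N v \<le> 1 \<and>
        transpose A *v y + transpose E *v v + transpose C *v \<mu> = 0}"

definition dual_objective ::
  "real ^ 'm \<Rightarrow> real \<Rightarrow> real ^ 'l \<Rightarrow>
   (real ^ 'm) \<times> (real ^ 'l) \<times> (real ^ 'r) \<Rightarrow> real" where
  "dual_objective b \<sigma> d = (\<lambda>(y, \<mu>, v). b \<bullet> y + \<sigma> * norm y + d \<bullet> \<mu>)"

text \<open>The primal value is not required to be attained, only the dual one.\<close>

definition strong_duality ::
  "real ^ 'n ^ 'm \<Rightarrow> real ^ 'm \<Rightarrow> real ^ 'n ^ 'r \<Rightarrow> real \<Rightarrow> (real ^ 'r \<Rightarrow> real) \<Rightarrow>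
   real ^ 'n ^ 'l \<Rightarrow> real ^ 'l \<Rightarrow> bool" where
  "strong_duality A b E \<sigma> N C d \<longleftrightarrow>
     (\<exists>w. is_solution (dual_objective b \<sigma> d) (dual_feasible A E N C) w) \<and>
     optimal_value (primal_objective E N) (primal_feasible A b \<sigma> C d) =
       - optimal_value (dual_objective b \<sigma> d) (dual_feasible A E N C)"

end

theory Submission
  imports Defs
begin

text \<open>(i) Weak duality is a chain of three inequalities; strong duality makes all of them equalities,
  among them the Cauchy--Schwarz estimate \<open>y \<bullet> (A x - b) \<le> \<sigma> \<parallel>y\<parallel>\<close>, whose
  equality case is the formula for \<open>A x - b\<close>. The multiplier \<open>y\<close> cannot vanish because
  \<open>d \<bullet> \<mu> \<ge> 0\<close> while the dual value is negative.
  (ii) The midpoint of two dual solutions is feasible, so the Euclidean norm is additive on them and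
  \<open>y\<close>, \<open>y'\<close> are positively proportional; the objective being positively homogeneous with
  nonzero optimal value, the factor is \<open>1\<close>.\<close>

text \<open>Serves to obtain continuity of \<open>N\<close>: a convex function on an open subset of
  a Euclidean space is continuous.\<close>

lemma is_norm_convex:
  assumes "is_norm N"
  shows "convex_on UNIV N"
proof (rule convex_onI)
  fix t :: real and x y
  assume "0 < t" "t < 1"
  then show "N ((1 - t) *\<^sub>R x + t *\<^sub>R y) \<le> (1 - t) * N x + t * N y"
    using assms unfolding is_norm_def
    by (smt (verit))
qed simp

text \<open>One half of the equivalence of norms. The constant is the minimum of \<open>N\<close>
  over the compact Euclidean unit sphere, positive by definiteness; homogeneity carries the bound to
  all vectors.\<close>

lemma is_norm_ge_euclidean:
  fixes N :: "'a::euclidean_space \<Rightarrow> real"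
  assumes "is_norm N"
  obtains c where "c > 0" "\<And>x. c * norm x \<le> N x"
proof -
  have cont: "continuous_on (sphere 0 1) N"
    using convex_on_continuous[OF open_UNIV is_norm_convex[OF assms]] continuous_on_subset
    by blast
  have ne: "sphere (0::'a) 1 \<noteq> {}"
    by simp
  obtain z where z: "z \<in> sphere 0 1" "\<And>x. x \<in> sphere 0 1 \<Longrightarrow> N z \<le> N x"
    using continuous_attains_inf[OF compact_sphere ne cont] by blast
  show thesis
  proof (rule that)
    have "z \<noteq> 0"
      using z(1) by auto
    then show "N z > 0"
      using assms unfolding is_norm_def by (metis order_le_less)
    fix x
    show "N z * norm x \<le> N x"
    proof (cases "x = 0")
      case True
      then show ?thesis
        using assms by (simp add: is_norm_def)
    next
      case False
      have "N z \<le> N ((1 / norm x) *\<^sub>R x)"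
        using False by (intro z(2)) simp
      also have "\<dots> = N x / norm x"
        using assms by (simp add: is_norm_def)
      finally show ?thesis
        using False by (simp add: field_simps)
    qed
  qed
qed

text \<open>Trades the supremum for a family of half-spaces, the form in which both weak duality and
  the convexity of the dual ball can be read off. From left to right, rescale \<open>x\<close> to
  the unit sphere of \<open>N\<close>.\<close>

lemma dual_norm_le_1_iff:
  fixes N :: "'a::euclidean_space \<Rightarrow> real"
  assumes N: "is_norm N"
  shows "dual_norm N z \<le> 1 \<longleftrightarrow> (\<forall>x. z \<bullet> x \<le> N x)"
proof
  assume le: "dual_norm N z \<le> 1"
  obtain c where c: "c > 0" "\<And>x. c * norm x \<le> N x"
    using is_norm_ge_euclidean[OF N] by blast
  \<comment> \<open>A real \<open>Sup\<close> is known to dominate its set only if the set is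
    bounded above. Here the unit ball of \<open>N\<close> lies in the Euclidean ball of radius
    \<open>1 / c\<close>.\<close>
  have bdd: "bdd_above {z \<bullet> v | v. N v \<le> 1}"
  proof (rule bdd_aboveI)
    fix s
    assume "s \<in> {z \<bullet> v | v. N v \<le> 1}"
    then obtain v where v: "s = z \<bullet> v" "N v \<le> 1"
      by blast
    have "norm v \<le> 1 / c"
      using c(1) c(2)[of v] v(2) by (simp add: field_simps)
    then have "norm z * norm v \<le> norm z * (1 / c)"
      by (intro mult_left_mono) auto
    then show "s \<le> norm z * (1 / c)"
      using norm_cauchy_schwarz[of z v] v(1) by linarith
  qed
  show "\<forall>x. z \<bullet> x \<le> N x"
  proof
    fix x
    show "z \<bullet> x \<le> N x"
    proof (cases "x = 0")
      case True
      then show ?thesis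
        using N by (simp add: is_norm_def)
    next
      case False
      then have pos: "N x > 0"
        using N unfolding is_norm_def by (metis order_le_less)
      have "N ((1 / N x) *\<^sub>R x) \<le> 1"
        using N pos by (simp add: is_norm_def)
      then have "z \<bullet> ((1 / N x) *\<^sub>R x) \<le> dual_norm N z"
        unfolding dual_norm_def by (intro cSup_upper[OF _ bdd]) blast
      then have "z \<bullet> x / N x \<le> 1"
        using le by simp
      then show ?thesis
        using pos by (simp add: field_simps)
    qed
  qed
next
  assume le: "\<forall>x. z \<bullet> x \<le> N x"
  have "N 0 = 0"
    using N by (simp add: is_norm_def)
  then have "{z \<bullet> v | v. N v \<le> 1} \<noteq> {}"
    by (auto intro!: exI[of _ 0])
  then show "dual_norm N z \<le> 1"
    unfolding dual_norm_def by (rule cSup_least) (use le order_trans in blast)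
qed

lemma is_solution_feasible: "is_solution f S x \<Longrightarrow> x \<in> S"
  by (simp add: is_solution_def is_arg_min_def)

lemma is_solution_le: "is_solution f S x \<Longrightarrow> u \<in> S \<Longrightarrow> f x \<le> f u"
  by (auto simp: is_solution_def is_arg_min_def not_less)

lemma optimal_value_eq:
  assumes "is_solution f S x"
  shows "optimal_value f S = ereal (f x)"
  unfolding optimal_value_def
  using is_solution_feasible[OF assms] is_solution_le[OF assms]
  by (intro antisym INF_lower INF_greatest) auto

lemma inner_mono_vec:
  fixes \<mu> x y :: "real ^ 'n"
  assumes "0 \<le> \<mu>" "x \<le> y"
  shows "\<mu> \<bullet> x \<le> \<mu> \<bullet> y"
  using assms unfolding inner_vec_def less_eq_vec_def
  by (auto intro!: sum_mono mult_left_mono)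

lemma inner_transpose: "(transpose A *v y) \<bullet> x = y \<bullet> (A *v x)"
  for A :: "real ^ 'n ^ 'm"
  by (simp add: dot_lmul_matrix)

text \<open>The dual constraint paired with \<open>x\<close>, the transposes moved across: the
  identity from which weak duality starts.\<close>

lemma dual_feasible_inner:
  assumes "(y, \<mu>, v) \<in> dual_feasible A E N C"
  shows "y \<bullet> (A *v x) + v \<bullet> (E *v x) + \<mu> \<bullet> (C *v x) = 0"
proof -
  have "(transpose A *v y + transpose E *v v + transpose C *v \<mu>) \<bullet> x = 0"
    using assms by (simp add: dual_feasible_def)
  then show ?thesis
    by (simp only: inner_add_left inner_transpose)
qed

text \<open>The hypotheses close the chain \<open>y \<bullet> z\<close> \<le>
  \<open>norm y * norm z\<close> \<le> \<open>norm y * s\<close> \<le> \<open>y \<bullet> z\<close>,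
  so Cauchy-Schwarz is an equality and \<open>norm z = s\<close>.\<close>

lemma eq_scaleR_if_inner_le:
  fixes y z :: "'a::real_inner"
  assumes "y \<noteq> 0" "norm z \<le> s" "s * norm y \<le> y \<bullet> z"
  shows "z = (s / norm y) *\<^sub>R y"
proof -
  have "norm y * norm z \<le> norm y * s"
    using assms(2) by (intro mult_left_mono) auto
  then have *: "y \<bullet> z = norm y * norm z" "norm y * norm z = norm y * s"
    using assms(3) norm_cauchy_schwarz[of y z] mult.commute[of s "norm y"] by linarith+
  then have "norm z = s" "norm y *\<^sub>R z = norm z *\<^sub>R y"
    using assms(1) norm_cauchy_schwarz_eq[of y z] by auto
  then have "norm y *\<^sub>R z = norm y *\<^sub>R ((s / norm y) *\<^sub>R y)"
    using assms(1) by simp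
  then show ?thesis
    using assms(1) by (simp only: scaleR_cancel_left norm_eq_zero) simp
qed

lemma dual_feasible_midpoint:
  assumes N: "is_norm N"
    and w: "(y, \<mu>, v) \<in> dual_feasible A E N C"
    and w': "(y', \<mu>', v') \<in> dual_feasible A E N C"
  shows "((1/2) *\<^sub>R (y + y'), (1/2) *\<^sub>R (\<mu> + \<mu>'), (1/2) *\<^sub>R (v + v')) \<in> dual_feasible A E N C"
proof -
  have "0 \<le> (1/2) *\<^sub>R (\<mu> + \<mu>')"
    using w w' by (auto simp: dual_feasible_def less_eq_vec_def)
  moreover have "dual_norm N ((1/2) *\<^sub>R (v + v')) \<le> 1"
  proof -
    have "v \<bullet> x \<le> N x" "v' \<bullet> x \<le> N x" for x
      using w w' dual_norm_le_1_iff[OF N] by (auto simp: dual_feasible_def)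
    then have "((1/2) *\<^sub>R (v + v')) \<bullet> x \<le> N x" for x
      by (simp add: inner_add_left) (smt (verit) field_sum_of_halves)
    then show ?thesis
      using dual_norm_le_1_iff[OF N] by blast
  qed
  moreover have "transpose A *v ((1/2) *\<^sub>R (y + y')) + transpose E *v ((1/2) *\<^sub>R (v + v'))
      + transpose C *v ((1/2) *\<^sub>R (\<mu> + \<mu>')) = 0"
  proof -
    have "transpose A *v ((1/2) *\<^sub>R (y + y')) + transpose E *v ((1/2) *\<^sub>R (v + v'))
        + transpose C *v ((1/2) *\<^sub>R (\<mu> + \<mu>'))
      = (1/2) *\<^sub>R ((transpose A *v y + transpose E *v v + transpose C *v \<mu>)
        + (transpose A *v y' + transpose E *v v' + transpose C *v \<mu>'))"
      by (simp add: matrix_vector_mult_scaleR matrix_vector_right_distrib scaleR_add_right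
          del: transpose_matrix_vector)
    also have "\<dots> = 0"
      using w w' by (simp add: dual_feasible_def del: transpose_matrix_vector)
    finally show ?thesis .
  qed
  ultimately show ?thesis
    by (simp add: dual_feasible_def del: transpose_matrix_vector)
qed

theorem lemma4p3:
  fixes A :: "real ^ 'n ^ 'm" and b :: "real ^ 'm" and E :: "real ^ 'n ^ 'r"
    and \<sigma> :: real and N :: "real ^ 'r \<Rightarrow> real"
    and C :: "real ^ 'n ^ 'l" and d :: "real ^ 'l"
  assumes "\<sigma> > 0"
    and "is_norm N"
    and "primal_feasible A b \<sigma> C d \<noteq> {}"
    and "norm b > \<sigma>"
    and "0 \<in> {x. C *v x \<le> d}"
    and "optimal_value (primal_objective E N) (primal_feasible A b \<sigma> C d) > 0"
    and "strong_duality A b E \<sigma> N C d"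
  shows
    "(\<forall>y \<mu> v. is_solution (dual_objective b \<sigma> d) (dual_feasible A E N C) (y, \<mu>, v) \<longrightarrow>
        y \<noteq> 0 \<and>
        (\<forall>x. is_solution (primal_objective E N) (primal_feasible A b \<sigma> C d) x \<longrightarrow>
           A *v x - b = (\<sigma> / norm y) *\<^sub>R y \<and>
           (d = 0 \<longrightarrow> N (E *v x) = - (b \<bullet> y) - \<sigma> * norm y))) \<and>
     (d = 0 \<longrightarrow>
        (\<forall>y \<mu> v y' \<mu>' v'.
           is_solution (dual_objective b \<sigma> d) (dual_feasible A E N C) (y, \<mu>, v) \<and>
           is_solution (dual_objective b \<sigma> d) (dual_feasible A E N C) (y', \<mu>', v') \<longrightarrow>
           y = y'))"
proof -
  let ?g = "dual_objective b \<sigma> d" and ?D = "dual_feasible A E N C"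
  let ?f = "primal_objective E N" and ?P = "primal_feasible A b \<sigma> C d"
  have d: "0 \<le> d"
    using assms(5) by simp
  \<comment> \<open>Strong duality with the dual value attained at \<open>w\<close>: the primal
    value is a finite real.\<close>
  have opt: "optimal_value ?f ?P = ereal (- ?g w)" if "is_solution ?g ?D w" for w
    using assms(7) optimal_value_eq[OF that] by (simp add: strong_duality_def)
  have neg: "?g w < 0" if "is_solution ?g ?D w" for w
    using assms(6) opt[OF that] by simp
  have nz: "y \<noteq> 0" if sol: "is_solution ?g ?D (y, \<mu>, v)" for y \<mu> v
  proof
    assume "y = 0"
    moreover have "0 \<le> d \<bullet> \<mu>"
      using inner_mono_vec[OF d, of 0 \<mu>] is_solution_feasible[OF sol]
      by (simp add: dual_feasible_def)
    ultimately show False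
      using neg[OF sol] by (simp add: dual_objective_def)
  qed
  have residual: "A *v x - b = (\<sigma> / norm y) *\<^sub>R y"
    and attained: "d = 0 \<longrightarrow> N (E *v x) = - (b \<bullet> y) - \<sigma> * norm y"
    if sol: "is_solution ?g ?D (y, \<mu>, v)" and x: "is_solution ?f ?P x" for y \<mu> v x
  proof -
    have eq: "N (E *v x) = - (b \<bullet> y) - \<sigma> * norm y - d \<bullet> \<mu>"
      using opt[OF sol] optimal_value_eq[OF x]
      by (simp add: primal_objective_def dual_objective_def)
    then show "d = 0 \<longrightarrow> N (E *v x) = - (b \<bullet> y) - \<sigma> * norm y"
      by simp
    have feas: "C *v x \<le> d" "norm (A *v x - b) \<le> \<sigma>"
      using is_solution_feasible[OF x] by (auto simp: primal_feasible_def)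
    have mu: "0 \<le> \<mu>" and v: "v \<bullet> (E *v x) \<le> N (E *v x)"
      using is_solution_feasible[OF sol] dual_norm_le_1_iff[OF assms(2)]
      by (auto simp: dual_feasible_def)
    have "\<mu> \<bullet> (C *v x) \<le> d \<bullet> \<mu>"
      using inner_mono_vec[OF mu feas(1)] by (simp add: inner_commute)
    \<comment> \<open>The paired constraint gives \<open>y \<bullet> (A *v x)\<close> \<ge>
      \<open>- N (E *v x) - d \<bullet> \<mu>\<close>, and by \<open>eq\<close> the right side is
      \<open>b \<bullet> y + \<sigma> * norm y\<close>.\<close>
    then have "\<sigma> * norm y \<le> y \<bullet> (A *v x - b)"
      using eq v dual_feasible_inner[OF is_solution_feasible[OF sol], of x]
      by (simp add: inner_diff_right inner_commute)
    then show "A *v x - b = (\<sigma> / norm y) *\<^sub>R y"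
      using eq_scaleR_if_inner_le nz[OF sol] feas(2) by blast
  qed
  have unique: "y = y'"
    if d0: "d = 0" and sol: "is_solution ?g ?D (y, \<mu>, v)"
      and sol': "is_solution ?g ?D (y', \<mu>', v')" for y \<mu> v y' \<mu>' v'
  proof -
    have same: "b \<bullet> y + \<sigma> * norm y = b \<bullet> y' + \<sigma> * norm y'"
      using opt[OF sol] opt[OF sol'] d0 by (simp add: dual_objective_def)
    have "?g (y, \<mu>, v) \<le> ?g ((1/2) *\<^sub>R (y + y'), (1/2) *\<^sub>R (\<mu> + \<mu>'), (1/2) *\<^sub>R (v + v'))"
      using is_solution_le[OF sol] is_solution_feasible[OF sol] is_solution_feasible[OF sol']
        dual_feasible_midpoint[OF assms(2)] by blast
    \<comment> \<open>By \<open>same\<close>, the left side is also the mean of the two optimal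
      values; the linear terms then cancel and only the norms remain.\<close>
    then have "b \<bullet> y + \<sigma> * norm y \<le> (b \<bullet> y + b \<bullet> y' + \<sigma> * norm (y + y')) / 2"
      using d0 by (simp add: dual_objective_def inner_add_right add_divide_distrib)
    then have "\<sigma> * (norm y + norm y') \<le> \<sigma> * norm (y + y')"
      using same by (simp add: algebra_simps)
    then have "norm (y + y') = norm y + norm y'"
      using assms(1) norm_triangle_ineq[of y y'] by simp
    then have par: "norm y *\<^sub>R y' = norm y' *\<^sub>R y"
      by (simp add: norm_triangle_eq)
    \<comment> \<open>Pair \<open>par\<close> with \<open>b\<close> and add
      \<open>\<sigma> * norm y * norm y'\<close> to both sides. The two brackets are the same
      negative number, so it cancels.\<close>
    have "norm y * (b \<bullet> y' + \<sigma> * norm y') = norm y' * (b \<bullet> y + \<sigma> * norm y)"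
      using arg_cong[OF par, of "\<lambda>u. b \<bullet> u"] by (simp add: algebra_simps)
    moreover have "b \<bullet> y + \<sigma> * norm y < 0"
      using neg[OF sol] d0 by (simp add: dual_objective_def)
    ultimately have "norm y = norm y'"
      using same by simp
    then show ?thesis
      using par nz[OF sol] by auto
  qed
  show ?thesis
    using nz residual attained unique by blast
qed

end
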